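(* Let $\mathcal{G}$ be an undirected, unweighted cycle graph of order $n$. Let $m<n$ be such that $p=n/m$ is an integer. Consider sets $S$ of $m$ noise-free leaders. Then any set $S$ of $m$ leaders that are uniformly distributed around the cycle, i.e. such that the geodesic distance between any leader and each of the two closest other leaders (its neighbouring leaders in the two directions around the cycle) is $p$, is an optimal leader set.
   Context: Setting. $\mathcal{G}$ is the cycle on $n\ge3$ nodes with all edge weights equal to $1$, $A$ its adjacency matrix, $D$ the diagonal degree matrix, and $L=D-A$ the Laplacian. With the nodes labelled $0,1,\dots,n-1$ consecutively around the cycle, a set of $m$ uniformly distributed leaders is a set of the form $\{j,\,j+p,\,\dots,\,j+(m-1)p\}$ modulo $n$ (this also covers $m=1$ and $m=2$). Dynamics and error. For a nonempty set $S$ of nodes (leaders) and $k>0$, let $K$ be the diagonal matrix with $K_{i,i}=k$ for $i\in S$ and $K_{i,i}=0$ otherwise; $M=L+K$. For $\sigma>0$ the dynamics are $d\mathbf{x}=-M\mathbf{x}\,dt+\sigma\,d\mathbf{W}$, with $\mathbf{W}$ a vector of $n$ independent standard Wiener processes. $\Sigma$ is the steady-state covariance matrix of $\mathbf{x}$, i.e. the solution of $M\Sigma+\Sigma M^T=\sigma^2 I$. The total system error is $\mathrm{tr}(\Sigma)=\sum_{i=1}^n\Sigma_{i,i}=\frac{\sigma^2}{2}\sum_{i=1}^n (M^{-1})_{i,i}$. For noise-free leaders the total system error means the limit of this quantity as $k\to\infty$. An optimal leader set is a set of $m$ nodes minimizing the total system error over all sets of $m$ nodes. *)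

theory Defs
  imports Complex_Main "Jordan_Normal_Form.Matrix"
begin

definition mat_trace :: "real mat \<Rightarrow> real" where
  "mat_trace B = (\<Sum>i<dim_row B. B $$ (i, i))"

definition cycle_edge :: "nat \<Rightarrow> nat \<Rightarrow> nat \<Rightarrow> bool" where
  "cycle_edge n i j \<longleftrightarrow> i < n \<and> j < n \<and> (j = (i + 1) mod n \<or> i = (j + 1) mod n)"

definition cycle_adjacency :: "nat \<Rightarrow> real mat" where
  "cycle_adjacency n = mat n n (\<lambda>(i, j). if cycle_edge n i j then 1 else 0)"

definition degree_mat :: "real mat \<Rightarrow> real mat" where
  "degree_mat A = mat_diag (dim_row A) (\<lambda>i. \<Sum>j<dim_col A. A $$ (i, j))"

definition laplacian :: "real mat \<Rightarrow> real mat" where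
  "laplacian A = degree_mat A - A"

definition leader_gain :: "nat \<Rightarrow> real \<Rightarrow> nat set \<Rightarrow> real mat" where
  "leader_gain n k S = mat_diag n (\<lambda>i. if i \<in> S then k else 0)"

definition system_mat :: "nat \<Rightarrow> real \<Rightarrow> nat set \<Rightarrow> real mat" where
  "system_mat n k S = laplacian (cycle_adjacency n) + leader_gain n k S"

text \<open>
  The steady-state covariance of \<open>dx = - M x dt + \<sigma> dW\<close> is the solution of the
  Lyapunov equation below. For \<open>k > 0\<close> and nonempty \<open>S\<close> the matrix \<open>M\<close> is symmetric
  positive definite (the cycle being connected), so the solution exists and is unique.
\<close>
definition steady_state_covariance :: "nat \<Rightarrow> real \<Rightarrow> real \<Rightarrow> nat set \<Rightarrow> real mat" where
  "steady_state_covariance n \<sigma> k S =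
     (THE X. X \<in> carrier_mat n n \<and>
        system_mat n k S * X + X * transpose_mat (system_mat n k S) = \<sigma>\<^sup>2 \<cdot>\<^sub>m 1\<^sub>m n)"

definition total_system_error :: "nat \<Rightarrow> real \<Rightarrow> real \<Rightarrow> nat set \<Rightarrow> real" where
  "total_system_error n \<sigma> k S = mat_trace (steady_state_covariance n \<sigma> k S)"

definition noise_free_error :: "nat \<Rightarrow> real \<Rightarrow> nat set \<Rightarrow> real" where
  "noise_free_error n \<sigma> S = Lim at_top (\<lambda>k. total_system_error n \<sigma> k S)"

definition leader_sets :: "nat \<Rightarrow> nat \<Rightarrow> nat set set" where
  "leader_sets n m = {S. S \<subseteq> {..<n} \<and> card S = m}"

definition optimal_noise_free_leaders :: "nat \<Rightarrow> real \<Rightarrow> nat \<Rightarrow> nat set \<Rightarrow> bool" where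
  "optimal_noise_free_leaders n \<sigma> m S \<longleftrightarrow>
     S \<in> leader_sets n m \<and>
     (\<forall>T \<in> leader_sets n m. noise_free_error n \<sigma> S \<le> noise_free_error n \<sigma> T)"

text \<open>
  For \<open>m \<ge> 2\<close> dividing \<open>n\<close>, these are the \<open>m\<close>-sets in which the two neighbouring leaders of
  any leader are at geodesic distance \<open>n div m\<close>; for \<open>m = 1\<close> they are all the singletons.
\<close>
definition uniformly_distributed :: "nat \<Rightarrow> nat \<Rightarrow> nat set \<Rightarrow> bool" where
  "uniformly_distributed n m S \<longleftrightarrow>
     (\<exists>j<n. S = (\<lambda>i. (j + i * (n div m)) mod n) ` {..<m})"

end

theory Submission
  imports Defs "Jordan_Normal_Form.Determinant" "HOL-Number_Theory.Cong"
begin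

text \<open>
  The error is computed exactly, for every nonempty leader set \<open>S\<close>, as a function of the gaps
  between consecutive leaders. The Lyapunov equation has the solution \<open>\<Sigma> = (\<sigma>\<^sup>2 / 2) M\<inverse>\<close>, so the
  error is half of \<open>\<sigma>\<^sup>2\<close> times the trace of \<open>M\<inverse>\<close>. As the gain \<open>k\<close> tends to infinity the
  leaders are pinned to zero, and the diagonal entry of \<open>M\<inverse>\<close> at a follower tends to the diagonal
  of the Green function of the Laplacian with zero values on \<open>S\<close>. The leaders cut the cycle into
  paths that do not interact, and on a path of length \<open>g\<close> with grounded ends the Green function
  with pole at distance \<open>a\<close> from one end is a tent of height \<open>a (g - a) / g\<close>. Summing over \<open>a\<close>,
  a gap of length \<open>g\<close> contributes \<open>(g\<^sup>2 - 1) / 6\<close> to the trace (\<open>noise_free_error_eq\<close>).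

  The \<open>m\<close> gaps add up to \<open>n = m p\<close>. By convexity the sum of their squares is at least \<open>m p\<^sup>2\<close>
  (\<open>noise_free_error_ge\<close>); a uniformly distributed set has no gap longer than \<open>p\<close>, hence
  attains the bound (\<open>noise_free_error_le\<close>).

  The limit in \<open>k\<close> is obtained without a formula for \<open>M\<inverse>\<close> at finite \<open>k\<close>:
  \<open>inverse_diagonal_squeeze\<close> compares a column of \<open>M\<inverse>\<close> with the Green function \<open>u\<close>. Since
  \<open>u\<close> vanishes on \<open>S\<close>, the vector \<open>M u\<close> does not depend on \<open>k\<close>, and the energy
  \<open>\<langle>x, M x\<rangle>\<close>, which dominates \<open>k\<close> times the squared values of \<open>x\<close> on the leaders, forces the
  difference to be of order \<open>1 / k\<close>.
\<close>

section \<open>The grounded Laplacian as an operator on functions\<close>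

text \<open>
  The action of the system matrix on functions (\<open>system_mat_row\<close>). The predecessor of \<open>i\<close> on the
  cycle is written \<open>(i + (n - 1)) mod n\<close> to avoid truncated subtraction at \<open>i = 0\<close>.
\<close>
definition grounded_op :: "nat \<Rightarrow> real \<Rightarrow> nat set \<Rightarrow> (nat \<Rightarrow> real) \<Rightarrow> nat \<Rightarrow> real" where
  "grounded_op n k S f i =
     2 * f i - f ((i + 1) mod n) - f ((i + (n - 1)) mod n) + (if i \<in> S then k * f i else 0)"

lemma grounded_op_diff:
  "grounded_op n k S (\<lambda>l. f l - g l) i = grounded_op n k S f i - grounded_op n k S g i"
  by (simp add: grounded_op_def algebra_simps)

lemma mod_succ_pred:
  assumes "i < (n::nat)"
  shows "((i + (n - 1)) mod n + 1) mod n = i" "((i + 1) mod n + (n - 1)) mod n = i"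
proof -
  have "((i + (n - 1)) mod n + 1) mod n = (i + n) mod n"
    using assms by (subst mod_add_left_eq) simp
  then show "((i + (n - 1)) mod n + 1) mod n = i" using assms by simp
  have "((i + 1) mod n + (n - 1)) mod n = (i + n) mod n"
    using assms by (subst mod_add_left_eq) simp
  then show "((i + 1) mod n + (n - 1)) mod n = i" using assms by simp
qed

lemma bij_betw_mod_succ: "bij_betw (\<lambda>i. (i + 1) mod n) {..<n} {..<n::nat}"
proof (rule bij_betw_byWitness[where f' = "\<lambda>i. (i + (n - 1)) mod n"])
  show "\<forall>i\<in>{..<n}. ((i + 1) mod n + (n - 1)) mod n = i"
    "\<forall>i\<in>{..<n}. ((i + (n - 1)) mod n + 1) mod n = i"
    by (intro ballI; simp only: mod_succ_pred lessThan_iff)+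
qed auto

lemma sum_mod_succ: "(\<Sum>i<n. h ((i + 1) mod n)) = (\<Sum>i<n. h i)" for n :: nat
  using sum.reindex_bij_betw[OF bij_betw_mod_succ, of h] .

lemma sum_mod_pred_mult:
  fixes f g :: "nat \<Rightarrow> real"
  shows "(\<Sum>i<n. g i * f ((i + (n - 1)) mod n)) = (\<Sum>i<n. g ((i + 1) mod n) * f i)"
proof -
  have "(\<Sum>i<n. g i * f ((i + (n - 1)) mod n))
      = (\<Sum>i<n. g ((i + 1) mod n) * f (((i + 1) mod n + (n - 1)) mod n))"
    by (rule sum_mod_succ[symmetric])
  also have "\<dots> = (\<Sum>i<n. g ((i + 1) mod n) * f i)"
    by (rule sum.cong) (simp_all only: mod_succ_pred lessThan_iff)
  finally show ?thesis .
qed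

text \<open>
  Summation by parts on the cycle. The symmetric right-hand side gives self-adjointness, and
  \<open>g = f\<close> turns it into the energy of \<open>f\<close>, a sum of squares.
\<close>
lemma grounded_op_bilinear:
  assumes "S \<subseteq> {..<n}"
  shows "(\<Sum>i<n. g i * grounded_op n k S f i)
       = (\<Sum>i<n. (g i - g ((i + 1) mod n)) * (f i - f ((i + 1) mod n))) + k * (\<Sum>i\<in>S. g i * f i)"
proof -
  have S: "(\<Sum>i<n. g i * (if i \<in> S then k * f i else 0)) = k * (\<Sum>i\<in>S. g i * f i)"
  proof -
    have "(\<Sum>i<n. g i * (if i \<in> S then k * f i else 0)) = (\<Sum>i<n. if i \<in> S then k * (g i * f i) else 0)"
      by (rule sum.cong) auto
    also have "\<dots> = (\<Sum>i\<in>{..<n} \<inter> S. k * (g i * f i))"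
      by (simp add: sum.inter_restrict)
    finally show ?thesis using assms by (simp add: Int_absorb1 sum_distrib_left)
  qed
  have "(\<Sum>i<n. g i * grounded_op n k S f i)
      = 2 * (\<Sum>i<n. g i * f i) - (\<Sum>i<n. g i * f ((i + 1) mod n))
        - (\<Sum>i<n. g i * f ((i + (n - 1)) mod n)) + k * (\<Sum>i\<in>S. g i * f i)"
    unfolding S[symmetric]
    by (simp add: grounded_op_def algebra_simps sum.distrib sum_subtractf sum_distrib_left)
  also have "\<dots> = (\<Sum>i<n. g i * f i) + (\<Sum>i<n. g ((i + 1) mod n) * f ((i + 1) mod n))
      - (\<Sum>i<n. g i * f ((i + 1) mod n)) - (\<Sum>i<n. g ((i + 1) mod n) * f i) + k * (\<Sum>i\<in>S. g i * f i)"
    unfolding sum_mod_pred_mult using sum_mod_succ[of "\<lambda>i. g i * f i" n] by simp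
  also have "\<dots> = (\<Sum>i<n. (g i - g ((i + 1) mod n)) * (f i - f ((i + 1) mod n))) + k * (\<Sum>i\<in>S. g i * f i)"
    by (simp add: algebra_simps sum.distrib sum_subtractf)
  finally show ?thesis .
qed

lemma grounded_op_selfadjoint:
  assumes "S \<subseteq> {..<n}"
  shows "(\<Sum>i<n. g i * grounded_op n k S f i) = (\<Sum>i<n. f i * grounded_op n k S g i)"
  unfolding grounded_op_bilinear[OF assms] by (simp add: mult.commute)

lemma system_mat_carrier: "system_mat n k S \<in> carrier_mat n n"
  by (simp add: system_mat_def laplacian_def degree_mat_def leader_gain_def cycle_adjacency_def
      mat_diag_def)

text \<open>
  Three nodes are needed for the two neighbours of a node to be different; on two nodes the
  adjacency matrix would count the common neighbour only once.
\<close>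
lemma cycle_adjacency_row:
  assumes "n \<ge> 3" "i < n"
  shows "(\<Sum>j<n. cycle_adjacency n $$ (i, j) * f j) = f ((i + 1) mod n) + f ((i + (n - 1)) mod n)"
proof -
  have nb: "cycle_edge n i j \<longleftrightarrow> j \<in> {(i + 1) mod n, (i + (n - 1)) mod n}" if "j < n" for j
    using assms that mod_succ_pred[of i n] mod_succ_pred[of j n] by (auto simp: cycle_edge_def)
  have ne: "(i + 1) mod n \<noteq> (i + (n - 1)) mod n"
    using assms by (cases "i = 0"; cases "i = n - 1") (auto simp: mod_if)
  have "(\<Sum>j<n. cycle_adjacency n $$ (i, j) * f j)
      = (\<Sum>j<n. if j \<in> {(i + 1) mod n, (i + (n - 1)) mod n} then f j else 0)"
    using assms by (intro sum.cong) (auto simp: cycle_adjacency_def nb simp del: insert_iff)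
  also have "\<dots> = (\<Sum>j\<in>{..<n} \<inter> {(i + 1) mod n, (i + (n - 1)) mod n}. f j)"
    by (simp only: sum.inter_restrict finite_lessThan)
  also have "{..<n} \<inter> {(i + 1) mod n, (i + (n - 1)) mod n} = {(i + 1) mod n, (i + (n - 1)) mod n}"
    using assms by auto
  finally show ?thesis using ne by simp
qed

lemma system_mat_row:
  assumes "n \<ge> 3" "i < n"
  shows "(\<Sum>j<n. system_mat n k S $$ (i, j) * f j) = grounded_op n k S f i"
proof -
  have A: "dim_row (cycle_adjacency n) = n" "dim_col (cycle_adjacency n) = n"
    by (simp_all add: cycle_adjacency_def)
  \<comment> \<open>the degree is the row sum against the constant function 1\<close>
  have deg: "(\<Sum>j<n. cycle_adjacency n $$ (i, j)) = 2"
    using cycle_adjacency_row[OF assms, of "\<lambda>_. 1"] by simp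
  have "system_mat n k S $$ (i, j) * f j
      = (if j = i then (2 + (if i \<in> S then k else 0)) * f j else 0)
        - cycle_adjacency n $$ (i, j) * f j" if "j < n" for j
    using assms that A deg
    by (simp add: system_mat_def laplacian_def degree_mat_def leader_gain_def mat_diag_def algebra_simps)
  then have "(\<Sum>j<n. system_mat n k S $$ (i, j) * f j)
     = (\<Sum>j<n. (if j = i then (2 + (if i \<in> S then k else 0)) * f j else 0)
          - cycle_adjacency n $$ (i, j) * f j)"
    by (intro sum.cong) auto
  then show ?thesis
    using assms cycle_adjacency_row[OF assms, of f]
    by (simp add: sum_subtractf grounded_op_def algebra_simps)
qed

section \<open>Positive definiteness and the steady-state covariance\<close>

locale leader_cycle =
  fixes n :: nat and S :: "nat set"
  assumes n_ge_3: "3 \<le> n" and leaders_subset: "S \<subseteq> {..<n}" and leaders_nonempty: "S \<noteq> {}"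
begin

abbreviation M :: "real \<Rightarrow> real mat" where "M k \<equiv> system_mat n k S"

lemma n_pos: "0 < n" using n_ge_3 by simp

lemma finite_leaders: "finite S" using leaders_subset finite_subset by blast

lemma leader_less: "s \<in> S \<Longrightarrow> s < n" using leaders_subset by auto

lemma energy_ge_leaders:
  "k * (\<Sum>i\<in>S. (f i)\<^sup>2) \<le> (\<Sum>i<n. f i * grounded_op n k S f i)"
  unfolding grounded_op_bilinear[OF leaders_subset]
  by (simp add: power2_eq_square sum_nonneg)

lemma energy_nonneg: "0 < k \<Longrightarrow> 0 \<le> (\<Sum>i<n. f i * grounded_op n k S f i)"
  using energy_ge_leaders[of k f] sum_nonneg[of S "\<lambda>i. (f i)\<^sup>2"]
  by (smt (verit) mult_nonneg_nonneg zero_le_power2)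

text \<open>
  Zero energy makes \<open>f\<close> constant along the edges and zero at some leader, and the cycle is
  connected: walking from that leader reaches every node.
\<close>
lemma energy_zero_imp:
  assumes k: "0 < k" and E: "(\<Sum>i<n. f i * grounded_op n k S f i) = 0" and i: "i < n"
  shows "f i = 0"
proof -
  have nn: "0 \<le> (\<Sum>i<n. (f i - f ((i + 1) mod n)) * (f i - f ((i + 1) mod n)))"
       "0 \<le> k * (\<Sum>i\<in>S. f i * f i)"
    using k by (simp_all add: sum_nonneg)
  have z: "(\<Sum>i<n. (f i - f ((i + 1) mod n)) * (f i - f ((i + 1) mod n))) = 0"
       "k * (\<Sum>i\<in>S. f i * f i) = 0"
    using nn E unfolding grounded_op_bilinear[OF leaders_subset] by linarith+
  have step: "f ((j + 1) mod n) = f j" if "j < n" for j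
  proof -
    have "\<forall>i\<in>{..<n}. (f i - f ((i + 1) mod n)) * (f i - f ((i + 1) mod n)) = 0"
      by (rule iffD1[OF sum_nonneg_eq_0_iff z(1)]) simp_all
    then have "(f j - f ((j + 1) mod n)) * (f j - f ((j + 1) mod n)) = 0"
      using that by blast
    then show ?thesis by simp
  qed
  obtain s where s: "s \<in> S" using leaders_nonempty by auto
  have fs: "f s = 0"
    using z(2) k s finite_leaders by (auto simp: sum_nonneg_eq_0_iff)
  have "f ((s + t) mod n) = 0" for t
  proof (induction t)
    case 0
    then show ?case using fs leader_less[OF s] by simp
  next
    case (Suc t)
    have "f ((s + Suc t) mod n) = f (((s + t) mod n + 1) mod n)"
      by (simp add: mod_simps)
    then show ?case using step[of "(s + t) mod n"] Suc n_pos by simp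
  qed
  from this[of "i + (n - s)"] show ?thesis
    using i leader_less[OF s] by simp
qed

text \<open>
  Multiplying by \<open>M\<close> on the left acts on the columns, multiplying by its transpose on the right
  acts on the rows.
\<close>
lemma mult_mat_index:
  assumes "X \<in> carrier_mat n n" "i < n" "j < n"
  shows "(M k * X) $$ (i, j) = grounded_op n k S (\<lambda>l. X $$ (l, j)) i"
    and "(X * transpose_mat (M k)) $$ (i, j) = grounded_op n k S (\<lambda>l. X $$ (i, l)) j"
  using assms system_mat_carrier[of n k S]
  by (simp_all add: scalar_prod_def atLeast0LessThan mult.commute[of "X $$ _"]
      flip: system_mat_row[OF n_ge_3])

lemma ex_inverse:
  assumes k: "0 < k"
  shows "\<exists>B. B \<in> carrier_mat n n \<and> M k * B = 1\<^sub>m n \<and> B * M k = 1\<^sub>m n"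
proof -
  note C = system_mat_carrier[of n k S]
  have "det (M k) \<noteq> 0"
  proof
    assume "det (M k) = 0"
    then obtain v where v: "v \<in> carrier_vec n" "v \<noteq> 0\<^sub>v n" "M k *\<^sub>v v = 0\<^sub>v n"
      using det_0_iff_vec_prod_zero_field[OF C] by auto
    have "grounded_op n k S (\<lambda>l. v $ l) i = 0" if "i < n" for i
    proof -
      have "(M k *\<^sub>v v) $ i = grounded_op n k S (\<lambda>l. v $ l) i"
        using that v(1) C
        by (simp add: scalar_prod_def atLeast0LessThan flip: system_mat_row[OF n_ge_3])
      then show ?thesis using v(3) that by simp
    qed
    then have "(\<Sum>i<n. v $ i * grounded_op n k S (\<lambda>l. v $ l) i) = 0" by simp
    then have "v $ i = 0" if "i < n" for i using energy_zero_imp[OF k _ that] by simp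
    then have "v = 0\<^sub>v n" using v(1) by (intro eq_vecI) auto
    then show False using v(2) by simp
  qed
  then have "M k \<in> Units (ring_mat TYPE(real) n ())"
    by (rule det_non_zero_imp_unit[OF C])
  then show ?thesis by (auto simp: Units_def ring_mat_simps)
qed

definition inv_mat :: "real \<Rightarrow> real mat" where
  "inv_mat k = (SOME B. B \<in> carrier_mat n n \<and> M k * B = 1\<^sub>m n \<and> B * M k = 1\<^sub>m n)"

lemma inv_mat:
  assumes "0 < k"
  shows "inv_mat k \<in> carrier_mat n n" "M k * inv_mat k = 1\<^sub>m n" "inv_mat k * M k = 1\<^sub>m n"
  using someI_ex[OF ex_inverse[OF assms]] unfolding inv_mat_def by auto

text \<open>
  Let \<open>D\<close> be the difference of two solutions. The homogeneous equation, multiplied entrywise by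
  \<open>D\<close> and summed, says that the energies of all columns and all rows of \<open>D\<close> add up to zero.
  Each is nonnegative, so each column has zero energy and vanishes.
\<close>
lemma lyapunov_unique:
  assumes k: "0 < k"
    and X: "X \<in> carrier_mat n n" "M k * X + X * transpose_mat (M k) = Q"
    and Y: "Y \<in> carrier_mat n n" "M k * Y + Y * transpose_mat (M k) = Q"
  shows "X = Y"
proof -
  define D where "D i j = X $$ (i, j) - Y $$ (i, j)" for i j
  have eq: "grounded_op n k S (\<lambda>l. D l j) i + grounded_op n k S (\<lambda>l. D i l) j = 0"
    if "i < n" "j < n" for i j
  proof -
    have "(M k * X + X * transpose_mat (M k)) $$ (i, j) = (M k * Y + Y * transpose_mat (M k)) $$ (i, j)"
      using X(2) Y(2) by simp
    then show ?thesis
      using that X(1) Y(1) system_mat_carrier[of n k S]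
      by (simp add: D_def grounded_op_diff mult_mat_index[OF X(1)] mult_mat_index[OF Y(1)]
          del: index_mult_mat(1))
  qed
  let ?cols = "\<Sum>j<n. \<Sum>i<n. D i j * grounded_op n k S (\<lambda>l. D l j) i"
  let ?rows = "\<Sum>i<n. \<Sum>j<n. D i j * grounded_op n k S (\<lambda>l. D i l) j"
  have "?cols + ?rows = (\<Sum>i<n. \<Sum>j<n. D i j * grounded_op n k S (\<lambda>l. D l j) i) + ?rows"
    by (subst sum.swap) simp
  also have "\<dots> = (\<Sum>i<n. \<Sum>j<n. D i j *
      (grounded_op n k S (\<lambda>l. D l j) i + grounded_op n k S (\<lambda>l. D i l) j))"
    by (simp add: sum.distrib distrib_left)
  also have "\<dots> = 0" by (simp add: eq)
  finally have "?cols + ?rows = 0" .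
  moreover have "0 \<le> ?cols" "0 \<le> ?rows"
    by (intro sum_nonneg energy_nonneg[OF k])+
  ultimately have "?cols = 0" by linarith
  then have "(\<Sum>i<n. D i j * grounded_op n k S (\<lambda>l. D l j) i) = 0" if "j < n" for j
    using that energy_nonneg[OF k] by (subst (asm) sum_nonneg_eq_0_iff) auto
  then have "D i j = 0" if "i < n" "j < n" for i j
    using energy_zero_imp[OF k _ that(1), of "\<lambda>i. D i j"] that by simp
  then show ?thesis
    using X(1) Y(1) by (intro eq_matI) (auto simp: D_def)
qed

lemma system_mat_symmetric: "transpose_mat (M k) = M k"
proof (rule eq_matI)
  fix i j assume "i < dim_row (M k)" "j < dim_col (M k)"
  then have "i < n" "j < n" using system_mat_carrier[of n k S] by auto
  then show "transpose_mat (M k) $$ (i, j) = M k $$ (i, j)"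
    by (simp add: system_mat_def laplacian_def degree_mat_def leader_gain_def cycle_adjacency_def
        mat_diag_def cycle_edge_def disj_commute)
qed (use system_mat_carrier[of n k S] in auto)

lemma steady_state_covariance_eq:
  assumes k: "0 < k"
  shows "steady_state_covariance n \<sigma> k S = (\<sigma>\<^sup>2 / 2) \<cdot>\<^sub>m inv_mat k"
  unfolding steady_state_covariance_def
proof (rule the_equality)
  note C = system_mat_carrier[of n k S] and B = inv_mat[OF k]
  have "M k * ((\<sigma>\<^sup>2 / 2) \<cdot>\<^sub>m inv_mat k) + ((\<sigma>\<^sup>2 / 2) \<cdot>\<^sub>m inv_mat k) * transpose_mat (M k)
      = (\<sigma>\<^sup>2 / 2) \<cdot>\<^sub>m (M k * inv_mat k) + (\<sigma>\<^sup>2 / 2) \<cdot>\<^sub>m (inv_mat k * M k)"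
    unfolding system_mat_symmetric
    using mult_smult_distrib[OF C B(1)] mult_smult_assoc_mat[OF B(1) C] by simp
  also have "\<dots> = \<sigma>\<^sup>2 \<cdot>\<^sub>m 1\<^sub>m n" unfolding B by (intro eq_matI) auto
  finally show sol: "(\<sigma>\<^sup>2 / 2) \<cdot>\<^sub>m inv_mat k \<in> carrier_mat n n \<and>
      M k * ((\<sigma>\<^sup>2 / 2) \<cdot>\<^sub>m inv_mat k) + ((\<sigma>\<^sup>2 / 2) \<cdot>\<^sub>m inv_mat k) * transpose_mat (M k) = \<sigma>\<^sup>2 \<cdot>\<^sub>m 1\<^sub>m n"
    using B(1) by simp
  show "X = (\<sigma>\<^sup>2 / 2) \<cdot>\<^sub>m inv_mat k"
    if "X \<in> carrier_mat n n \<and> M k * X + X * transpose_mat (M k) = \<sigma>\<^sup>2 \<cdot>\<^sub>m 1\<^sub>m n" for X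
    using lyapunov_unique[OF k] that sol by blast
qed

lemma total_system_error_eq:
  assumes k: "0 < k"
  shows "total_system_error n \<sigma> k S = \<sigma>\<^sup>2 / 2 * (\<Sum>i<n. inv_mat k $$ (i, i))"
  using inv_mat(1)[OF k]
  by (simp add: total_system_error_def mat_trace_def steady_state_covariance_eq[OF k] sum_distrib_left)

lemma inv_mat_column:
  assumes "0 < k" "i < n" "j < n"
  shows "grounded_op n k S (\<lambda>l. inv_mat k $$ (l, j)) i = (if i = j then 1 else 0)"
  using mult_mat_index(1)[OF inv_mat(1)[OF assms(1)] assms(2,3), of k] inv_mat(2)[OF assms(1)] assms
  by simp

section \<open>The noise-free limit\<close>

text \<open>
  Write \<open>e\<close> for the unit vector at \<open>i\<close>, so that \<open>x\<close> is the column of the inverse at \<open>i\<close> and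
  \<open>M u = e - r\<close> with \<open>r\<close> supported on \<open>S\<close>; the gain does not act on \<open>u\<close>, hence \<open>r\<close> is
  independent of \<open>k\<close>. Self-adjointness gives \<open>x i - u i = \<langle>r, x\<rangle> = d\<close>. On the other hand
  \<open>M (x - u) = r\<close>, so \<open>d\<close> is also the energy of \<open>x - u\<close>, which is at least \<open>k\<close> times the sum of
  \<open>x\<^sup>2\<close> over the leaders. The lower bound follows from \<open>d \<ge> 0\<close>; for the upper bound, Young's
  inequality for \<open>\<langle>r, x\<rangle>\<close> lets half of \<open>d\<close> absorb the terms in \<open>x\<^sup>2\<close>.
\<close>
lemma inverse_diagonal_squeeze:
  assumes k: "0 < k" and i: "i < n"
    and x: "\<And>j. j < n \<Longrightarrow> grounded_op n k S x j = (if j = i then 1 else 0)"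
    and u: "\<And>j. j \<in> S \<Longrightarrow> u j = 0"
    and uL: "\<And>j. j < n \<Longrightarrow> j \<notin> S \<Longrightarrow> grounded_op n 0 S u j = (if j = i then 1 else 0)"
  shows "u i \<le> x i"
    and "x i \<le> u i + (\<Sum>j\<in>S. ((if j = i then 1 else 0) - grounded_op n 0 S u j)\<^sup>2) / k"
proof -
  define r where "r j = (if j = i then 1 else 0) - grounded_op n 0 S u j" for j
  define d where "d = (\<Sum>j\<in>S. r j * x j)"
  have ku: "grounded_op n k S u j = grounded_op n 0 S u j" for j
    using u[of j] by (simp add: grounded_op_def)
  have r0: "r j = 0" if "j < n" "j \<notin> S" for j using uL that by (simp add: r_def)
  have onS: "(\<Sum>j<n. r j * f j) = (\<Sum>j\<in>S. r j * f j)" for f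
    by (rule sum.mono_neutral_right) (use leaders_subset r0 in auto)
  have single: "(\<Sum>j<n. f j * (if j = i then 1 else 0)) = f i" for f :: "nat \<Rightarrow> real"
    using i by (simp add: if_distrib cong: if_cong)
  have "u i = (\<Sum>j<n. u j * grounded_op n k S x j)"
    using single[of u] x by simp
  also have "\<dots> = (\<Sum>j<n. x j * grounded_op n k S u j)"
    by (rule grounded_op_selfadjoint[OF leaders_subset])
  also have "\<dots> = (\<Sum>j<n. x j * (if j = i then 1 else 0)) - (\<Sum>j<n. r j * x j)"
    unfolding sum_subtractf[symmetric] by (rule sum.cong) (simp_all add: ku r_def algebra_simps)
  finally have xd: "x i = u i + d" by (simp add: single onS d_def)
  have "k * (\<Sum>j\<in>S. (x j - u j)\<^sup>2) \<le> (\<Sum>j<n. (x j - u j) * grounded_op n k S (\<lambda>l. x l - u l) j)"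
    by (rule energy_ge_leaders)
  also have "\<dots> = (\<Sum>j<n. r j * (x j - u j))"
  proof (rule sum.cong)
    fix j assume "j \<in> {..<n}"
    then have "grounded_op n k S (\<lambda>l. x l - u l) j = r j"
      using x[of j] by (simp add: r_def grounded_op_diff ku)
    then show "(x j - u j) * grounded_op n k S (\<lambda>l. x l - u l) j = r j * (x j - u j)" by simp
  qed simp
  also have "\<dots> = d" unfolding onS d_def by (rule sum.cong) (simp_all add: u)
  finally have low: "k * (\<Sum>j\<in>S. (x j)\<^sup>2) \<le> d" by (simp add: u cong: sum.cong)
  have "d \<le> (\<Sum>j\<in>S. (r j)\<^sup>2 / (2 * k) + k * (x j)\<^sup>2 / 2)"
    unfolding d_def
  proof (rule sum_mono)
    fix j
    have "0 \<le> (r j - k * x j)\<^sup>2 / (2 * k)" using k by simp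
    also have "\<dots> = (r j)\<^sup>2 / (2 * k) + k * (x j)\<^sup>2 / 2 - r j * x j"
      using k by (simp add: power2_eq_square field_simps)
    finally show "r j * x j \<le> (r j)\<^sup>2 / (2 * k) + k * (x j)\<^sup>2 / 2" by simp
  qed
  also have "\<dots> = (\<Sum>j\<in>S. (r j)\<^sup>2) / k / 2 + k * (\<Sum>j\<in>S. (x j)\<^sup>2) / 2"
    by (simp add: sum.distrib sum_divide_distrib sum_distrib_left mult.commute)
  finally have "d \<le> (\<Sum>j\<in>S. (r j)\<^sup>2) / k" using low by simp
  then show "x i \<le> u i + (\<Sum>j\<in>S. ((if j = i then 1 else 0) - grounded_op n 0 S u j)\<^sup>2) / k"
    using xd by (simp add: r_def)
  have "0 \<le> k * (\<Sum>j\<in>S. (x j)\<^sup>2)" using k by (intro mult_nonneg_nonneg sum_nonneg) auto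
  then show "u i \<le> x i" using low xd by simp
qed

lemma inverse_diagonal_limit:
  assumes i: "i < n"
    and u: "\<And>j. j \<in> S \<Longrightarrow> u j = 0"
    and uL: "\<And>j. j < n \<Longrightarrow> j \<notin> S \<Longrightarrow> grounded_op n 0 S u j = (if j = i then 1 else 0)"
  shows "((\<lambda>k. inv_mat k $$ (i, i)) \<longlongrightarrow> u i) at_top"
proof (rule tendsto_sandwich)
  let ?C = "\<Sum>j\<in>S. ((if j = i then 1 else 0) - grounded_op n 0 S u j)\<^sup>2"
  note sq = inverse_diagonal_squeeze[OF _ i inv_mat_column[OF _ _ i] u uL]
  show "\<forall>\<^sub>F k in at_top. u i \<le> inv_mat k $$ (i, i)"
    using eventually_gt_at_top[of 0] by eventually_elim (use sq in blast)
  show "\<forall>\<^sub>F k in at_top. inv_mat k $$ (i, i) \<le> u i + ?C / k"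
    using eventually_gt_at_top[of 0] by eventually_elim (use sq in blast)
  have "((\<lambda>k. u i + ?C / k) \<longlongrightarrow> u i + 0) at_top"
    by (intro tendsto_add tendsto_const tendsto_divide_0[OF tendsto_const]
        filterlim_at_top_imp_at_infinity filterlim_ident)
  then show "((\<lambda>k. u i + ?C / k) \<longlongrightarrow> u i) at_top" by simp
qed simp

section \<open>Gaps between consecutive leaders\<close>

text \<open>
  The distance from a leader to the next one in the direction of increasing labels. A single
  leader is its own successor, at distance \<open>n\<close>.
\<close>
definition gap :: "nat \<Rightarrow> nat" where
  "gap s = (LEAST g. 0 < g \<and> (s + g) mod n \<in> S)"

lemma gap_props:
  assumes "s \<in> S"
  shows "0 < gap s" "(s + gap s) mod n \<in> S"
proof -
  have "0 < n \<and> (s + n) mod n \<in> S" using assms leader_less n_pos by simp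
  from LeastI[of "\<lambda>g. 0 < g \<and> (s + g) mod n \<in> S", OF this]
  show "0 < gap s" "(s + gap s) mod n \<in> S" by (simp_all add: gap_def)
qed

lemma gap_least: "0 < g \<Longrightarrow> (s + g) mod n \<in> S \<Longrightarrow> gap s \<le> g"
  unfolding gap_def by (rule Least_le) simp

text \<open>
  Coordinates of the nodes: the pair \<open>(s, t)\<close> stands for the node \<open>t\<close> steps after the leader
  \<open>s\<close>, before the next leader is reached. Leaders have \<open>t = 0\<close>.
\<close>
definition arc_coords :: "(nat \<times> nat) set" where
  "arc_coords = (SIGMA s:S. {..<gap s})"

definition node :: "nat \<times> nat \<Rightarrow> nat" where
  "node = (\<lambda>(s, t). (s + t) mod n)"

text \<open>
  Going back \<open>t\<close> steps from the common node shows that the leader \<open>s\<close> lies \<open>t' - t\<close> steps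
  after \<open>s'\<close>; this is less than the gap of \<open>s'\<close>, so it must be zero.
\<close>
lemma node_eq_imp_ordered:
  assumes "s \<in> S" "s' \<in> S" "t' < gap s'" "t \<le> t'" "(s + t) mod n = (s' + t') mod n"
  shows "s = s' \<and> t = t'"
proof -
  have "[s + t = (s' + (t' - t)) + t] (mod n)" using assms by (simp add: cong_def)
  then have "[s = s' + (t' - t)] (mod n)" by (simp only: cong_add_rcancel_nat)
  then have s: "(s' + (t' - t)) mod n = s" using leader_less[OF assms(1)] by (simp add: cong_def)
  have "t' - t = 0"
    using gap_least[of "t' - t" s'] s assms by (cases "t' - t = 0") auto
  then show ?thesis using s assms leader_less by auto
qed

lemma bij_betw_node: "bij_betw node arc_coords {..<n}"
proof (rule bij_betw_imageI)
  show "inj_on node arc_coords"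
  proof (rule inj_onI)
    fix a b assume ab: "a \<in> arc_coords" "b \<in> arc_coords" "node a = node b"
    obtain s t s' t' where [simp]: "a = (s, t)" "b = (s', t')" by fastforce
    show "a = b"
      using ab node_eq_imp_ordered[of s s' t' t] node_eq_imp_ordered[of s' s t t'] nat_le_linear[of t t']
      by (auto simp: arc_coords_def node_def)
  qed
  show "node ` arc_coords = {..<n}"
  proof
    show "node ` arc_coords \<subseteq> {..<n}" using n_pos by (auto simp: node_def)
    show "{..<n} \<subseteq> node ` arc_coords"
    proof
      fix i assume "i \<in> {..<n}"
      obtain s0 where s0: "s0 \<in> S" using leaders_nonempty by auto
      have base: "(s0 + (i + (n - s0))) mod n = i"
        using \<open>i \<in> {..<n}\<close> leader_less[OF s0] by simp
      \<comment> \<open>while the walk from a leader is longer than its gap, restart it at the next leader\<close>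
      have "\<exists>s\<in>S. \<exists>a<gap s. (s + a) mod n = i" if "s \<in> S" "(s + t) mod n = i" for s t
        using that
      proof (induction t arbitrary: s rule: less_induct)
        case (less t)
        show ?case
        proof (cases "t < gap s")
          case True
          then show ?thesis using less.prems by auto
        next
          case False
          have "((s + gap s) mod n + (t - gap s)) mod n = (s + gap s + (t - gap s)) mod n"
            by (rule mod_add_left_eq)
          then have "((s + gap s) mod n + (t - gap s)) mod n = i"
            using False less.prems by simp
          then show ?thesis
            using less.IH[of "t - gap s"] gap_props[OF less.prems(1)] False by auto
        qed
      qed
      then obtain s a where "s \<in> S" "a < gap s" "(s + a) mod n = i" using s0 base by blast
      then show "i \<in> node ` arc_coords"
        by (intro image_eqI[of _ _ "(s, a)"]) (auto simp: arc_coords_def node_def)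
    qed
  qed
qed

lemma sum_over_gaps: "(\<Sum>i<n. h i) = (\<Sum>s\<in>S. \<Sum>t<gap s. h ((s + t) mod n))"
proof -
  have "(\<Sum>i<n. h i) = (\<Sum>a\<in>arc_coords. h (node a))"
    by (rule sum.reindex_bij_betw[OF bij_betw_node, symmetric])
  then show ?thesis
    using finite_leaders by (simp add: arc_coords_def node_def sum.Sigma case_prod_beta)
qed

lemma sum_gap: "(\<Sum>s\<in>S. gap s) = n"
  using sum_over_gaps[of "\<lambda>_. 1::nat"] by simp

section \<open>The Green function of the followers\<close>

text \<open>
  The Green function of a path with nodes \<open>0, \<dots>, g\<close> and grounded ends, with pole at \<open>a\<close>: linear
  on both sides of the pole, with slopes \<open>(g - a) / g\<close> and \<open>- a / g\<close>, which differ by one.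
\<close>
definition tent :: "nat \<Rightarrow> nat \<Rightarrow> nat \<Rightarrow> real" where
  "tent g a t = real (min t a) * (real g - real (max t a)) / real g"

lemma tent_second_difference:
  assumes "0 < t" "t < g" "a < g"
  shows "2 * tent g a t - tent g a (t + 1) - tent g a (t - 1) = (if t = a then 1 else 0)"
proof -
  have g: "real g \<noteq> 0" using assms by simp
  consider "t < a" | "t = a" | d where "t = Suc (a + d)"
    using less_imp_Suc_add[of a t] by (cases t a rule: linorder_cases) auto
  then show ?thesis
    by cases (use assms g in \<open>auto simp: tent_def min_def max_def of_nat_diff field_simps\<close>)
qed

text \<open>
  The tent on the arc after \<open>s\<close>, extended by zero to the rest of the cycle; the pole is the
  node \<open>a\<close> steps after \<open>s\<close>.
\<close>
definition green :: "nat \<Rightarrow> nat \<Rightarrow> nat \<Rightarrow> real" where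
  "green s a j = (let (s', t) = inv_into arc_coords node j in if s' = s then tent (gap s) a t else 0)"

lemma green_arc:
  assumes "s' \<in> S" "t < gap s'"
  shows "green s a ((s' + t) mod n) = (if s' = s then tent (gap s) a t else 0)"
proof -
  have "inv_into arc_coords node (node (s', t)) = (s', t)"
    using bij_betw_node assms by (intro inv_into_f_f) (auto simp: bij_betw_def arc_coords_def)
  then show ?thesis by (simp add: green_def node_def)
qed

lemma green_leader: "j \<in> S \<Longrightarrow> green s a j = 0"
  using green_arc[of j 0 s a] gap_props(1)[of j] leader_less[of j] by (simp add: tent_def)

text \<open>
  The end \<open>t = gap s'\<close> of an arc is the next leader and has coordinates on another arc (or again
  on this one, if there is only one leader). The formula persists there because both sides are
  zero, so second differences at followers never have to cross from one arc to another.
\<close>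
lemma green_closed_arc:
  assumes "s' \<in> S" "t \<le> gap s'" "a < gap s"
  shows "green s a ((s' + t) mod n) = (if s' = s then tent (gap s) a t else 0)"
proof (cases "t = gap s'")
  case True
  then show ?thesis
    using green_leader[OF gap_props(2)[OF assms(1)]] assms by (auto simp: tent_def)
qed (use green_arc assms in auto)

lemma green_laplace:
  assumes s: "s \<in> S" "a < gap s" and j: "j < n" "j \<notin> S"
  shows "grounded_op n 0 S (green s a) j = (if j = (s + a) mod n then 1 else 0)"
proof -
  have "j \<in> node ` arc_coords" using bij_betw_node j by (simp add: bij_betw_def)
  then obtain s' t where t: "s' \<in> S" "t < gap s'" "j = (s' + t) mod n"
    by (auto simp: arc_coords_def node_def)
  have "t \<noteq> 0" using t j leader_less by (cases "t = 0") auto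
  then have t0: "0 < t" by simp
  have succ: "(j + 1) mod n = (s' + (t + 1)) mod n" by (simp add: t mod_simps)
  have pred: "(j + (n - 1)) mod n = (s' + (t - 1)) mod n"
  proof -
    have "(j + (n - 1)) mod n = (s' + t + (n - 1)) mod n" by (simp add: t mod_simps)
    also have "s' + t + (n - 1) = s' + (t - 1) + n" using t0 n_pos by simp
    finally show ?thesis by simp
  qed
  have centre: "j = (s + a) mod n \<longleftrightarrow> s' = s \<and> t = a"
  proof -
    have "node (s', t) = node (s, a) \<longleftrightarrow> (s', t) = (s, a)"
      using bij_betw_node s t by (intro inj_on_eq_iff[of node arc_coords]) (auto simp: bij_betw_def arc_coords_def)
    then show ?thesis using t by (simp add: node_def)
  qed
  have vals: "green s a ((s' + t) mod n) = (if s' = s then tent (gap s) a t else 0)"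
    "green s a ((s' + (t + 1)) mod n) = (if s' = s then tent (gap s) a (t + 1) else 0)"
    "green s a ((s' + (t - 1)) mod n) = (if s' = s then tent (gap s) a (t - 1) else 0)"
    using t(2) by (intro green_closed_arc t(1) s(2); simp)+
  have "grounded_op n 0 S (green s a) j
      = 2 * green s a ((s' + t) mod n) - green s a ((s' + (t + 1)) mod n) - green s a ((s' + (t - 1)) mod n)"
    unfolding grounded_op_def succ pred using t(3) j(2) by simp
  also have "\<dots> = (if s' = s \<and> t = a then 1 else 0)"
  proof (cases "s' = s")
    case True
    then show ?thesis
      unfolding vals using tent_second_difference[OF t0 _ s(2)] t(2) by simp
  next
    case False
    then show ?thesis unfolding vals by simp
  qed
  finally show ?thesis by (simp only: centre)
qed

text \<open>
  At \<open>a = 0\<close> this covers the leaders, where the tent is zero and the limit is 0.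
\<close>
lemma inv_mat_diagonal_limit:
  assumes "s \<in> S" "a < gap s"
  shows "((\<lambda>k. inv_mat k $$ ((s + a) mod n, (s + a) mod n)) \<longlongrightarrow>
           real a * (real (gap s) - real a) / real (gap s)) at_top"
  using inverse_diagonal_limit[of "(s + a) mod n" "green s a", OF _ green_leader green_laplace[OF assms]]
    green_arc[OF assms, of s a] n_pos by (simp add: tent_def)

section \<open>The error as a function of the gaps\<close>

text \<open>
  The upper limit \<open>h\<close> is kept apart from \<open>c\<close>, with both later equal to the gap, so that the
  sum can be evaluated by induction on \<open>h\<close>.
\<close>
lemma sum_mult_diff:
  "(\<Sum>a<h. real a * (c - real a)) = c * (real h * (real h - 1)) / 2
     - (real h - 1) * real h * (2 * real h - 1) / 6"
  by (induction h) (simp_all add: field_simps)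

lemma noise_free_error_eq:
  "noise_free_error n \<sigma> S = \<sigma>\<^sup>2 / 2 * (\<Sum>s\<in>S. ((real (gap s))\<^sup>2 - 1) / 6)"
proof -
  have "((\<lambda>k. \<sigma>\<^sup>2 / 2 * (\<Sum>i<n. inv_mat k $$ (i, i))) \<longlongrightarrow>
      \<sigma>\<^sup>2 / 2 * (\<Sum>s\<in>S. \<Sum>a<gap s. real a * (real (gap s) - real a) / real (gap s))) at_top"
    unfolding sum_over_gaps
    by (intro tendsto_mult tendsto_const tendsto_sum inv_mat_diagonal_limit) auto
  moreover have "(\<Sum>a<gap s. real a * (real (gap s) - real a) / real (gap s)) = ((real (gap s))\<^sup>2 - 1) / 6"
    if "s \<in> S" for s
    unfolding sum_divide_distrib[symmetric] sum_mult_diff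
    using gap_props(1)[OF that] by (simp add: field_simps power2_eq_square)
  ultimately have "((\<lambda>k. \<sigma>\<^sup>2 / 2 * (\<Sum>i<n. inv_mat k $$ (i, i))) \<longlongrightarrow>
      \<sigma>\<^sup>2 / 2 * (\<Sum>s\<in>S. ((real (gap s))\<^sup>2 - 1) / 6)) at_top"
    by simp
  then have "((\<lambda>k. total_system_error n \<sigma> k S) \<longlongrightarrow>
      \<sigma>\<^sup>2 / 2 * (\<Sum>s\<in>S. ((real (gap s))\<^sup>2 - 1) / 6)) at_top"
    by (rule Lim_transform_eventually)
       (use eventually_gt_at_top[of 0] in eventually_elim, simp add: total_system_error_eq)
  then show ?thesis
    unfolding noise_free_error_def by (intro tendsto_Lim) simp_all
qed

text \<open>
  The square lies above its tangent at \<open>p\<close>, which is the mean of the gaps, so the linear terms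
  of the tangents cancel in the sum.
\<close>
lemma noise_free_error_ge:
  assumes "n = card S * p"
  shows "\<sigma>\<^sup>2 / 2 * (real (card S) * (((real p)\<^sup>2 - 1) / 6)) \<le> noise_free_error n \<sigma> S"
proof -
  have tangent: "2 * real p * real (gap s) - (real p)\<^sup>2 \<le> (real (gap s))\<^sup>2" for s
    using zero_le_power2[of "real (gap s) - real p"] by (simp add: power2_eq_square algebra_simps)
  have "(\<Sum>s\<in>S. real (gap s)) = real (card S) * real p"
    using sum_gap assms by (metis of_nat_mult of_nat_sum)
  then have "real (card S) * (((real p)\<^sup>2 - 1) / 6)
      = (\<Sum>s\<in>S. (2 * real p * real (gap s) - (real p)\<^sup>2 - 1) / 6)"
    by (simp add: sum_subtractf power2_eq_square algebra_simps flip: sum_divide_distrib sum_distrib_left)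
  also have "\<dots> \<le> (\<Sum>s\<in>S. ((real (gap s))\<^sup>2 - 1) / 6)"
    by (intro sum_mono divide_right_mono diff_right_mono tangent) simp
  finally show ?thesis unfolding noise_free_error_eq by (intro mult_left_mono) auto
qed

lemma noise_free_error_le:
  assumes "\<And>s. s \<in> S \<Longrightarrow> gap s \<le> p"
  shows "noise_free_error n \<sigma> S \<le> \<sigma>\<^sup>2 / 2 * (real (card S) * (((real p)\<^sup>2 - 1) / 6))"
proof -
  have "(\<Sum>s\<in>S. ((real (gap s))\<^sup>2 - 1) / 6) \<le> (\<Sum>s\<in>S. ((real p)\<^sup>2 - 1) / 6)"
    by (intro sum_mono) (use assms in \<open>simp add: power_mono\<close>)
  then show ?thesis unfolding noise_free_error_eq by (intro mult_left_mono) auto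
qed

end

section \<open>Optimality of uniformly distributed leaders\<close>

theorem theorem3:
  fixes n m :: nat and \<sigma> :: real and S :: "nat set"
  assumes "n \<ge> 3" and "0 < m" and "m < n" and "m dvd n" and "\<sigma> > 0"
    and "uniformly_distributed n m S"
  shows "optimal_noise_free_leaders n \<sigma> m S"
proof -
  define p where "p = n div m"
  have n: "n = m * p" using assms(4) by (simp add: p_def)
  then have p: "0 < p" using assms(1) by (cases p) auto
  obtain j where j: "j < n" "S = (\<lambda>i. (j + i * p) mod n) ` {..<m}"
    using assms(6) by (auto simp: uniformly_distributed_def p_def)
  interpret S: leader_cycle n S
    using assms(1,2) j by unfold_locales auto
  have gap_le: "S.gap s \<le> p" if "s \<in> S" for s
  proof (rule S.gap_least[OF p])
    from that obtain i where i: "i < m" "s = (j + i * p) mod n" using j by auto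
    have "(s + p) mod n = (j + (i + 1) * p) mod n"
      by (simp add: i mod_simps algebra_simps)
    \<comment> \<open>the leader after the last one is the first, as \<open>m p = n\<close>\<close>
    also have "\<dots> = (j + ((i + 1) mod m) * p) mod n"
    proof (cases "i + 1 = m")
      case True
      then show ?thesis by (simp flip: n)
    qed (use i in simp)
    also have "\<dots> \<in> S" using j assms(2) by simp
    finally show "(s + p) mod n \<in> S" .
  qed
  \<comment> \<open>no two of the \<open>m\<close> leaders coincide: gaps of length at most \<open>p\<close> cover the cycle only if
    there are at least \<open>m\<close> of them\<close>
  have card: "card S = m"
  proof (rule antisym)
    show "card S \<le> m" using j card_image_le[of "{..<m}"] by (metis card_lessThan finite_lessThan)
    have "m * p \<le> card S * p"
      using sum_mono[of S S.gap "\<lambda>_. p"] gap_le S.sum_gap n by simp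
    then show "m \<le> card S" using p by simp
  qed
  show ?thesis
    unfolding optimal_noise_free_leaders_def
  proof (intro conjI ballI)
    show "S \<in> leader_sets n m" using card S.leaders_subset by (simp add: leader_sets_def)
    fix T assume "T \<in> leader_sets n m"
    then have T: "T \<subseteq> {..<n}" "card T = m" by (auto simp: leader_sets_def)
    then interpret T: leader_cycle n T
      using assms(1,2) by unfold_locales auto
    have "noise_free_error n \<sigma> S \<le> \<sigma>\<^sup>2 / 2 * (real m * (((real p)\<^sup>2 - 1) / 6))"
      using S.noise_free_error_le[OF gap_le] card by simp
    also have "\<dots> \<le> noise_free_error n \<sigma> T"
      using T.noise_free_error_ge[of p] T n by simp
    finally show "noise_free_error n \<sigma> S \<le> noise_free_error n \<sigma> T" .
  qed
qed

end
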